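(* Shard polytopes of type A are Ehrhart positive. That is, for every arc $\alpha=(a,b,A,B)$ with $1\le a<b\le n$, all coefficients of the Ehrhart polynomial of the shard polytope $\mathscr{SP}(\alpha)\subseteq\mathbb{R}^n$ are nonnegative.
   Context: An arc is a tuple $\alpha=(a,b,A,B)$ with integers $1\le a<b\le n$ and $A\sqcup B=\{a+1,\dots,b-1\}$ a partition into two (possibly empty) disjoint sets. An $\alpha$-fall is a position $j\in\{a,\dots,b-1\}$ such that $j\in\{a\}\cup A$ and $j+1\in B\cup\{b\}$; an $\alpha$-rise is a position $j\in\{a,\dots,b-1\}$ such that $j\in\{a\}\cup B$ and $j+1\in A\cup\{b\}$. The shard polytope $\mathscr{SP}(\alpha)$ (of type A) is the set of $(x_1,\dots,x_n)\in\mathbb{R}^n$ with $\sum_{i=1}^n x_i=0$ satisfying: - $x_i=0$ for $i\in\{1,\dots,n\}\setminus\{a,\dots,b\}$; - $x_{a'}\ge 0$ for $a'\in A$ and $x_{b'}\le 0$ for $b'\in B$; - $\sum_{i\le f}x_i\le 1$ for every $\alpha$-fall $f$; - $\sum_{i\le r}x_i\ge 0$ for every $\alpha$-rise $r$. It is a lattice polytope. The Ehrhart polynomial of a lattice polytope $\mathscr{P}\subseteq\mathbb{R}^n$ is the unique polynomial $\mathrm{ehr}(\mathscr{P},t)\in\mathbb{Q}[t]$ with $\mathrm{ehr}(\mathscr{P},t)=\#(t\mathscr{P}\cap\mathbb{Z}^n)$ for all positive integers $t$; $\mathscr{P}$ is Ehrhart positive if all coefficients of $\mathrm{ehr}(\mathscr{P},t)$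 are nonnegative. *)

theory Defs
  imports Complex_Main "HOL-Computational_Algebra.Polynomial"
begin

text \<open>
  Points of $R^n$ are functions on the naturals that vanish outside the index set
  \<open>{1..n}\<close>, so that coordinates are numbered from 1 and \<open>n\<close> is an ordinary natural number.
\<close>

definition real_space :: "nat \<Rightarrow> (nat \<Rightarrow> real) set" where
  "real_space n = {x. \<forall>i. i \<notin> {1..n} \<longrightarrow> x i = 0}"

definition int_lattice :: "nat \<Rightarrow> (nat \<Rightarrow> real) set" where
  "int_lattice n = {x \<in> real_space n. \<forall>i\<in>{1..n}. x i \<in> \<int>}"

definition dilate :: "nat \<Rightarrow> (nat \<Rightarrow> real) set \<Rightarrow> (nat \<Rightarrow> real) set" where
  "dilate t P = (\<lambda>x i. real t * x i) ` P"


definition is_arc :: "nat \<Rightarrow> nat \<Rightarrow> nat \<Rightarrow> nat set \<Rightarrow> nat set \<Rightarrow> bool" where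
  "is_arc n a b A B \<longleftrightarrow>
     1 \<le> a \<and> a < b \<and> b \<le> n \<and> A \<union> B = {a+1..b-1} \<and> A \<inter> B = {}"

definition falls :: "nat \<Rightarrow> nat \<Rightarrow> nat set \<Rightarrow> nat set \<Rightarrow> nat set" where
  "falls a b A B = {j \<in> {a..b-1}. j \<in> {a} \<union> A \<and> j + 1 \<in> B \<union> {b}}"

definition rises :: "nat \<Rightarrow> nat \<Rightarrow> nat set \<Rightarrow> nat set \<Rightarrow> nat set" where
  "rises a b A B = {j \<in> {a..b-1}. j \<in> {a} \<union> B \<and> j + 1 \<in> A \<union> {b}}"

definition shard_polytope ::
  "nat \<Rightarrow> nat \<Rightarrow> nat \<Rightarrow> nat set \<Rightarrow> nat set \<Rightarrow> (nat \<Rightarrow> real) set" where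
  "shard_polytope n a b A B = {x \<in> real_space n.
     (\<Sum>i=1..n. x i) = 0 \<and>
     (\<forall>i \<in> {1..n} - {a..b}. x i = 0) \<and>
     (\<forall>i\<in>A. x i \<ge> 0) \<and>
     (\<forall>i\<in>B. x i \<le> 0) \<and>
     (\<forall>f \<in> falls a b A B. (\<Sum>i=1..f. x i) \<le> 1) \<and>
     (\<forall>r \<in> rises a b A B. (\<Sum>i=1..r. x i) \<ge> 0)}"


text \<open>
  Finiteness is demanded explicitly because \<^const>\<open>card\<close> is 0 on infinite sets.
\<close>

definition is_ehrhart_polynomial :: "nat \<Rightarrow> (nat \<Rightarrow> real) set \<Rightarrow> rat poly \<Rightarrow> bool" where
  "is_ehrhart_polynomial n P p \<longleftrightarrow>
     (\<forall>t::nat. t > 0 \<longrightarrow>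
        finite (dilate t P \<inter> int_lattice n) \<and>
        poly p (of_nat t) = of_nat (card (dilate t P \<inter> int_lattice n)))"

lemma is_ehrhart_polynomial_unique:
  assumes "is_ehrhart_polynomial n P p" "is_ehrhart_polynomial n P q"
  shows "p = q"
proof (rule ccontr)
  assume "p \<noteq> q"
  then have "finite {x. poly (p - q) x = 0}"
    by (intro poly_roots_finite) simp
  moreover have "(of_nat :: nat \<Rightarrow> rat) ` {0<..} \<subseteq> {x. poly (p - q) x = 0}"
    using assms by (auto simp: is_ehrhart_polynomial_def)
  ultimately have "finite ((of_nat :: nat \<Rightarrow> rat) ` {0<..})"
    by (rule rev_finite_subset)
  then have "finite {0::nat<..}"
    by (rule finite_imageD) (simp add: inj_on_def)
  then show False
    by (simp add: infinite_Ioi)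
qed

definition ehrhart_polynomial :: "nat \<Rightarrow> (nat \<Rightarrow> real) set \<Rightarrow> rat poly" where
  "ehrhart_polynomial n P = (THE p. is_ehrhart_polynomial n P p)"

lemma ehrhart_polynomial_eqI:
  assumes "is_ehrhart_polynomial n P p"
  shows "ehrhart_polynomial n P = p"
  unfolding ehrhart_polynomial_def
  using assms is_ehrhart_polynomial_unique by blast

text \<open>
  Existence of the Ehrhart polynomial is part of the notion, so that it is never a statement
  about an unspecified value of the description operator.
\<close>

definition ehrhart_positive :: "nat \<Rightarrow> (nat \<Rightarrow> real) set \<Rightarrow> bool" where
  "ehrhart_positive n P \<longleftrightarrow>
     is_ehrhart_polynomial n P (ehrhart_polynomial n P) \<and>
     (\<forall>i. coeff (ehrhart_polynomial n P) i \<ge> 0)"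

end

theory Submission
  imports Defs "HOL-Library.FuncSet"
begin

text \<open>
  In terms of the partial sums $y_j = x_1 + \dots + x_j$, the condition $x_{j+1} \ge 0$ for
  \<open>j + 1 \<in> A\<close> says $y_j \le y_{j+1}$, and \<open>j + 1 \<in> B\<close> gives the reverse inequality. So
  $y_a, \dots, y_{b-1}$ is a sequence with prescribed ascents and descents, the falls and rises
  are its local maxima and minima, and the remaining conditions say that all its values lie in
  $[0,1]$. The shard polytope is thus the order polytope of a fence, a poset on consecutive
  integers in which each cover relation joins two neighbours. The passage to partial sums and
  its inverse preserve integrality, so lattice points of the $t$-th dilate correspond to
  order-preserving maps from the fence to $\{0,\dots,t\}$: if $\Omega(t)$ counts the maps into a
  $t$-element chain, the Ehrhart polynomial is $\Omega(t+1)$. It suffices that $\Omega$ has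
  nonnegative coefficients.

  Cutting a map into $\{0,\dots,s+t-1\}$ at height $s$ gives
  $\Omega_S(s+t) = \sum_I \Omega_I(s)\,\Omega_{S \setminus I}(t)$, where $I$ runs over the lower
  sets of $S$. Comparing the coefficients of $s$ expresses the derivative as
  $\Omega_S' = \sum_I \omega_I\,\Omega_{S \setminus I}$ with $\omega_I$ the linear coefficient of
  $\Omega_I$ (\<open>pderiv_order_poly\<close>). Since $\Omega_S(0) = 0$ for nonempty $S$, and since the empty
  $I$ contributes nothing, induction on the size of $S$ reduces the claim to $\omega_I \ge 0$ for
  all $I$.

  If $I$ is not an interval, $\Omega_I$ is a product of two polynomials without constant
  term, so $\omega_I = 0$. If $I$ is an interval, pick a descent. The maps satisfying $\ge$ there are
  all maps without a condition at this place except those satisfying $<$. Dropping the condition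
  disconnects the interval, which contributes $0$ to the linear coefficient, so changing $\ge$
  into $<$ changes only the sign of $\omega$. After $k$ such changes there remains a chain
  on $m + 1$ elements with $k$ strict and $m - k$ weak ascents, for which the number of maps is
  $\binom{t+m-k}{m+1}$; its linear coefficient has the sign of $(-1)^k$
  (\<open>interval_order_poly\<close>).
\<close>

section \<open>Maps with prescribed steps\<close>

text \<open>
  \<open>Strict_Up\<close> and \<open>Free\<close> do not occur in fences; they arise when a descent is resolved by
  inclusion-exclusion.
\<close>

datatype step = Weak_Up | Strict_Up | Weak_Down | Free

fun step_holds :: "step \<Rightarrow> nat \<Rightarrow> nat \<Rightarrow> bool" where
  "step_holds Weak_Up x y \<longleftrightarrow> x \<le> y"
| "step_holds Strict_Up x y \<longleftrightarrow> x < y"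
| "step_holds Weak_Down x y \<longleftrightarrow> y \<le> x"
| "step_holds Free x y \<longleftrightarrow> True"

text \<open>
  Only neighbours that both lie in \<open>S\<close> are compared. Hence the same step function describes all
  restrictions of a fence, and removing a point disconnects it.
\<close>
definition fence_maps :: "(nat \<Rightarrow> step) \<Rightarrow> nat set \<Rightarrow> nat \<Rightarrow> (nat \<Rightarrow> nat) set" where
  "fence_maps r S t =
     {f \<in> S \<rightarrow>\<^sub>E {..<t}. \<forall>i. i \<in> S \<longrightarrow> Suc i \<in> S \<longrightarrow> step_holds (r i) (f i) (f (Suc i))}"

definition is_order_poly :: "(nat \<Rightarrow> step) \<Rightarrow> nat set \<Rightarrow> rat poly \<Rightarrow> bool" where
  "is_order_poly r S p \<longleftrightarrow> (\<forall>t. poly p (of_nat t) = of_nat (card (fence_maps r S t)))"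

lemma finite_fence_maps: "finite S \<Longrightarrow> finite (fence_maps r S t)"
  by (rule finite_subset[of _ "S \<rightarrow>\<^sub>E {..<t}"]) (auto simp: fence_maps_def intro: finite_PiE)

lemma fence_maps_cong:
  assumes "\<And>i. i \<in> S \<Longrightarrow> Suc i \<in> S \<Longrightarrow> r i = r' i"
  shows "fence_maps r S t = fence_maps r' S t"
  using assms by (auto simp: fence_maps_def)

lemma fence_maps_empty: "fence_maps r {} t = {\<lambda>_. undefined}"
  by (auto simp: fence_maps_def)

lemma fence_maps_0: "S \<noteq> {} \<Longrightarrow> fence_maps r S 0 = {}"
  by (auto simp: fence_maps_def PiE_def)

lemma poly_eq_of_nat:
  fixes p q :: "rat poly"
  assumes "\<And>t::nat. poly p (of_nat t) = poly q (of_nat t)"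
  shows "p = q"
proof (rule ccontr)
  assume "p \<noteq> q"
  then have "finite {x. poly (p - q) x = 0}"
    by (intro poly_roots_finite) simp
  moreover have "range (of_nat :: nat \<Rightarrow> rat) \<subseteq> {x. poly (p - q) x = 0}"
    using assms by auto
  ultimately have "finite (range (of_nat :: nat \<Rightarrow> rat))"
    by (rule rev_finite_subset)
  then have "finite (UNIV :: nat set)"
    by (rule finite_imageD) (simp add: inj_on_def)
  then show False by simp
qed

lemma order_poly_unique: "is_order_poly r S p \<Longrightarrow> is_order_poly r S q \<Longrightarrow> p = q"
  by (rule poly_eq_of_nat) (simp add: is_order_poly_def)

lemma order_poly_coeff_0:
  assumes "is_order_poly r S p" "S \<noteq> {}"
  shows "coeff p 0 = 0"
proof -
  have "poly p (of_nat 0) = of_nat (card (fence_maps r S 0))"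
    using assms(1) unfolding is_order_poly_def by (rule spec)
  then have "poly p 0 = 0" using assms(2) by (simp add: fence_maps_0)
  then show ?thesis by (simp add: poly_0_coeff_0)
qed

lemma card_fence_maps_Un:
  assumes disj: "S1 \<inter> S2 = {}"
    and f12: "\<And>i. i \<in> S1 \<Longrightarrow> Suc i \<in> S2 \<Longrightarrow> r i = Free"
    and f21: "\<And>i. i \<in> S2 \<Longrightarrow> Suc i \<in> S1 \<Longrightarrow> r i = Free"
  shows "card (fence_maps r (S1 \<union> S2) t) = card (fence_maps r S1 t) * card (fence_maps r S2 t)"
proof -
  have "bij_betw (\<lambda>f. (restrict f S1, restrict f S2)) (fence_maps r (S1 \<union> S2) t)
          (fence_maps r S1 t \<times> fence_maps r S2 t)"
  proof (rule bij_betw_byWitness[where f' = "\<lambda>(g, h) i. if i \<in> S1 then g i else h i"])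
    show "\<forall>f\<in>fence_maps r (S1 \<union> S2) t.
        (case (restrict f S1, restrict f S2) of (g, h) \<Rightarrow> \<lambda>i. if i \<in> S1 then g i else h i) = f"
      by (auto simp: fence_maps_def fun_eq_iff PiE_def extensional_def)
    show "\<forall>gh\<in>fence_maps r S1 t \<times> fence_maps r S2 t.
        (restrict (case gh of (g, h) \<Rightarrow> \<lambda>i. if i \<in> S1 then g i else h i) S1,
         restrict (case gh of (g, h) \<Rightarrow> \<lambda>i. if i \<in> S1 then g i else h i) S2) = gh"
      using disj
      by (auto simp: fence_maps_def fun_eq_iff PiE_def extensional_def restrict_def)
    show "(\<lambda>f. (restrict f S1, restrict f S2)) ` fence_maps r (S1 \<union> S2) t
        \<subseteq> fence_maps r S1 t \<times> fence_maps r S2 t"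
      by (auto simp: fence_maps_def PiE_def)
    have "(\<lambda>i. if i \<in> S1 then g i else h i) \<in> fence_maps r (S1 \<union> S2) t"
      if "g \<in> fence_maps r S1 t" "h \<in> fence_maps r S2 t" for g h
      using that disj f12 f21
      by (auto simp: fence_maps_def PiE_def Pi_def extensional_def)
    then show "(\<lambda>(g, h) i. if i \<in> S1 then g i else h i) ` (fence_maps r S1 t \<times> fence_maps r S2 t)
        \<subseteq> fence_maps r (S1 \<union> S2) t"
      by auto
  qed
  then show ?thesis
    by (simp add: bij_betw_same_card card_cartesian_product)
qed

text \<open>
  The two conditions \<open>\<ge>\<close> and \<open><\<close> between neighbours are complementary.
\<close>
lemma card_fence_maps_flip:
  assumes "finite S" "i \<in> S" "Suc i \<in> S"
  shows "card (fence_maps (r(i := Weak_Down)) S t) + card (fence_maps (r(i := Strict_Up)) S t)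
         = card (fence_maps (r(i := Free)) S t)"
proof -
  have split_i: "f \<in> fence_maps (r(i := s)) S t \<longleftrightarrow> f \<in> S \<rightarrow>\<^sub>E {..<t} \<and>
      (\<forall>j. j \<noteq> i \<longrightarrow> j \<in> S \<longrightarrow> Suc j \<in> S \<longrightarrow> step_holds (r j) (f j) (f (Suc j))) \<and>
      step_holds s (f i) (f (Suc i))" for f s
    using assms(2,3) by (auto simp: fence_maps_def)
  have "fence_maps (r(i := Free)) S t
          = fence_maps (r(i := Weak_Down)) S t \<union> fence_maps (r(i := Strict_Up)) S t"
    by (rule set_eqI) (auto simp only: Un_iff split_i step_holds.simps not_le)
  moreover have "fence_maps (r(i := Weak_Down)) S t \<inter> fence_maps (r(i := Strict_Up)) S t = {}"
    by (auto simp: split_i)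
  ultimately show ?thesis
    using assms by (simp add: card_Un_disjoint finite_fence_maps)
qed

section \<open>Counting maps of a chain\<close>
definition strict_steps :: "(nat \<Rightarrow> step) \<Rightarrow> nat set \<Rightarrow> nat" where
  "strict_steps r S = card {i \<in> S. Suc i \<in> S \<and> r i = Strict_Up}"

lemma chain_mono:
  assumes f: "f \<in> fence_maps r {a..<c} t"
    and up: "\<And>i. a \<le> i \<Longrightarrow> Suc i < c \<Longrightarrow> r i \<in> {Weak_Up, Strict_Up}"
    and ij: "a \<le> i" "i \<le> j" "j < c"
  shows "f i \<le> f j"
  using ij(2,1,3)
proof (induction rule: dec_induct)
  case (step k)
  have "step_holds (r k) (f k) (f (Suc k))"
    using f step by (auto simp: fence_maps_def)
  moreover have "r k \<in> {Weak_Up, Strict_Up}"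
    using up step by auto
  ultimately have "f k \<le> f (Suc k)" by auto
  then show ?case using step by auto
qed simp

lemma strict_steps_Suc:
  "strict_steps r {a..<Suc (Suc (a + m))}
     = strict_steps r {a..<Suc (a + m)} + (if r (a + m) = Strict_Up then 1 else 0)"
proof -
  have "{i \<in> {a..<Suc (Suc (a + m))}. Suc i \<in> {a..<Suc (Suc (a + m))} \<and> r i = Strict_Up}
      = {i \<in> {a..<Suc (a + m)}. Suc i \<in> {a..<Suc (a + m)} \<and> r i = Strict_Up}
        \<union> (if r (a + m) = Strict_Up then {a + m} else {})"
    by (auto simp: less_Suc_eq)
  moreover have "a + m \<notin> {i \<in> {a..<Suc (a + m)}. Suc i \<in> {a..<Suc (a + m)} \<and> r i = Strict_Up}"
    by auto
  ultimately show ?thesis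
    unfolding strict_steps_def by (simp split: if_splits)
qed

lemma strict_steps_le: "strict_steps r {a..<Suc (a + m)} \<le> m"
proof (induction m)
  case 0
  then show ?case by (simp add: strict_steps_def)
next
  case (Suc m)
  then show ?case by (simp add: strict_steps_Suc)
qed

text \<open>
  In an ascending chain the last value is the largest. So a map into \<open>{..<Suc t}\<close> either avoids
  the value \<open>t\<close> altogether or ends in \<open>t\<close>; in the second case the rest of the map is
  arbitrary, except that a strict last step keeps it below \<open>t\<close>. This is Pascal's recursion.
\<close>
lemma card_fence_maps_chain_Suc:
  assumes up: "\<And>i. a \<le> i \<Longrightarrow> i \<le> a + m \<Longrightarrow> r i \<in> {Weak_Up, Strict_Up}"
  shows "card (fence_maps r {a..<Suc (Suc (a + m))} (Suc t))
       = card (fence_maps r {a..<Suc (Suc (a + m))} t)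
         + card (fence_maps r {a..<Suc (a + m)} (if r (a + m) = Strict_Up then t else Suc t))"
proof -
  let ?l = "Suc (a + m)" and ?u = "if r (a + m) = Strict_Up then t else Suc t"
  let ?S = "{a..<Suc (a + m)}"
  let ?T = "{a..<Suc (Suc (a + m))}"
  let ?ext = "\<lambda>g. g(?l := t)"
  have T: "?T = insert ?l ?S" by auto
  have "fence_maps r ?T (Suc t) \<subseteq> fence_maps r ?T t \<union> ?ext ` fence_maps r ?S ?u"
  proof
    fix f assume f: "f \<in> fence_maps r ?T (Suc t)"
    have mono: "f i \<le> f j" if "a \<le> i" "i \<le> j" "j < Suc ?l" for i j
      using chain_mono[OF f _ that] up by auto
    have vals: "f i < Suc t" if "i \<in> ?T" for i
      using f that by (auto simp: fence_maps_def)
    have ext: "f i = undefined" if "i \<notin> ?T" for i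
      using f that by (auto simp: fence_maps_def PiE_def extensional_def)
    have steps: "step_holds (r i) (f i) (f (Suc i))" if "i \<in> ?T" "Suc i \<in> ?T" for i
      using f that by (auto simp: fence_maps_def)
    show "f \<in> fence_maps r ?T t \<union> ?ext ` fence_maps r ?S ?u"
    proof (cases "f ?l < t")
      case True
      then have "f i < t" if "i \<in> ?T" for i
        using mono[of i ?l] that by auto
      then have "f \<in> fence_maps r ?T t"
        using ext steps by (auto simp: fence_maps_def PiE_def extensional_def)
      then show ?thesis by simp
    next
      case False
      then have fl: "f ?l = t" using vals[of ?l] by auto
      have less: "f i < ?u" if "i \<in> ?S" for i
      proof (cases "r (a + m) = Strict_Up")
        case True
        then have "f (a + m) < t" using steps[of "a + m"] fl by auto
        then show ?thesis using mono[of i "a + m"] that True by auto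
      next
        case False
        then show ?thesis using vals[of i] that by auto
      qed
      have "restrict f ?S \<in> fence_maps r ?S ?u"
        using less steps by (auto simp: fence_maps_def)
      moreover have "f = ?ext (restrict f ?S)"
        using fl ext by (auto simp: fun_eq_iff)
      ultimately show ?thesis by blast
    qed
  qed
  moreover have "?ext g \<in> fence_maps r ?T (Suc t)" if g: "g \<in> fence_maps r ?S ?u" for g
  proof -
    have vals: "g i < ?u" if "i \<in> ?S" for i
      using g that by (auto simp: fence_maps_def)
    have ext: "g i = undefined" if "i \<notin> ?S" for i
      using g that by (auto simp: fence_maps_def PiE_def extensional_def)
    have "step_holds (r i) (g i) (g (Suc i))" if "i \<in> ?S" "Suc i \<in> ?S" for i
      using g that by (auto simp: fence_maps_def)
    moreover have "step_holds (r (a + m)) (g (a + m)) t"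
      using vals[of "a + m"] up[of "a + m"] by auto
    ultimately have "step_holds (r i) (?ext g i) (?ext g (Suc i))" if "i \<in> ?T" "Suc i \<in> ?T" for i
      using that by (cases "i = a + m") auto
    moreover have "?ext g i < Suc t" if "i \<in> ?T" for i
      using vals[of i] that by (auto split: if_splits)
    moreover have "?ext g i = undefined" if "i \<notin> ?T" for i
      using ext[of i] that by auto
    ultimately show ?thesis
      unfolding fence_maps_def PiE_def extensional_def Pi_def by blast
  qed
  moreover have "fence_maps r ?T t \<subseteq> fence_maps r ?T (Suc t)"
    by (auto simp: fence_maps_def PiE_def Pi_def less_Suc_eq)
  ultimately have eq: "fence_maps r ?T (Suc t) = fence_maps r ?T t \<union> ?ext ` fence_maps r ?S ?u"
    by blast
  have "f ?l < t" if "f \<in> fence_maps r ?T t" for f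
  proof -
    have "f \<in> ?T \<rightarrow>\<^sub>E {..<t}" using that unfolding fence_maps_def by blast
    then show ?thesis using PiE_mem[of f ?T "\<lambda>_. {..<t}" ?l] by auto
  qed
  then have disj: "fence_maps r ?T t \<inter> ?ext ` fence_maps r ?S ?u = {}"
    by force
  have "inj_on ?ext (fence_maps r ?S ?u)"
  proof (rule inj_onI)
    fix g h assume g: "g \<in> fence_maps r ?S ?u" and h: "h \<in> fence_maps r ?S ?u"
      and e: "?ext g = ?ext h"
    have "g ?l = h ?l"
      using g h by (auto simp: fence_maps_def PiE_def extensional_def)
    moreover have "g i = h i" if "i \<noteq> ?l" for i
      using fun_cong[OF e, of i] that by simp
    ultimately show "g = h" by (metis ext)
  qed
  then show ?thesis
    using disj by (simp add: eq card_Un_disjoint finite_fence_maps card_image)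
qed

lemma card_fence_maps_chain:
  assumes "\<And>i. a \<le> i \<Longrightarrow> i < a + m \<Longrightarrow> r i \<in> {Weak_Up, Strict_Up}"
  shows "card (fence_maps r {a..<Suc (a + m)} t)
         = (t + (m - strict_steps r {a..<Suc (a + m)})) choose Suc m"
  using assms
proof (induction m arbitrary: t)
  case 0
  have "fence_maps r {a..<Suc (a + 0)} t = {a} \<rightarrow>\<^sub>E {..<t}"
    by (auto simp: fence_maps_def)
  then show ?case by (simp add: card_PiE)
next
  case (Suc m)
  have IH: "card (fence_maps r {a..<Suc (a + m)} t)
         = (t + (m - strict_steps r {a..<Suc (a + m)})) choose Suc m" for t
    using Suc.IH Suc.prems by simp
  have up: "r i \<in> {Weak_Up, Strict_Up}" if "a \<le> i" "i \<le> a + m" for i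
    using Suc.prems that by simp
  show ?case
  proof (induction t)
    case 0
    then show ?case by (simp add: fence_maps_0)
  next
    case (Suc t)
    show ?case
      using Suc card_fence_maps_chain_Suc[OF up] IH strict_steps_le[of r a m]
      by (auto simp: strict_steps_Suc Suc_diff_le)
  qed
qed

text \<open>
  The binomial coefficient is $\frac{1}{(m+1)!} \prod_{j \le m} (t + c - j)$. The factor with $j = c$ is
  $t$ itself, so the linear coefficient is $\frac{1}{(m+1)!}$ times the product of the $c - j$ with $j \ne c$,
  of which exactly the $k = m - c$ ones with $j > c$ are negative.
\<close>
lemma coeff_1_chain_poly:
  fixes c :: nat
  assumes "c + k = m"
  defines "p \<equiv> smult (1 / fact (Suc m)) (\<Prod>j<Suc m. [:of_nat c - of_nat j, 1:]) :: rat poly"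
  shows "poly p (of_nat t) = of_nat ((t + c) choose Suc m)"
    and "(-1) ^ k * coeff p 1 \<ge> 0"
proof -
  have "of_nat ((t + c) choose Suc m) = (of_nat (t + c) gchoose Suc m :: rat)"
    by (rule binomial_gbinomial)
  also have "\<dots> = (\<Prod>j<Suc m. of_nat (t + c) - of_nat j) / fact (Suc m)"
    by (simp only: gbinomial_prod_rev atLeast0LessThan)
  finally show "poly p (of_nat t) = of_nat ((t + c) choose Suc m)"
    by (simp add: p_def poly_prod add_diff_eq add.commute del: prod.lessThan_Suc fact_Suc)
next
  let ?R = "{..<Suc m} - {c}"
  have p: "p = smult (1 / fact (Suc m)) (pCons 0 (\<Prod>j\<in>?R. [:of_nat c - of_nat j, 1:]))"
  proof -
    have "(\<Prod>j<Suc m. [:of_nat c - of_nat j, 1:])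
        = [:of_nat c - of_nat c, 1:] * (\<Prod>j\<in>?R. [:of_nat c - of_nat j, 1:] :: rat poly)"
      by (rule prod.remove) (use assms(1) in auto)
    also have "\<dots> = pCons 0 (\<Prod>j\<in>?R. [:of_nat c - of_nat j, 1:])"
      by (simp del: lessThan_Suc)
    finally show ?thesis unfolding p_def by (rule arg_cong)
  qed
  have "coeff p 1 = 1 / fact (Suc m) * coeff (\<Prod>j\<in>?R. [:of_nat c - of_nat j, 1:]) 0"
    unfolding p by (simp only: coeff_smult coeff_pCons_Suc One_nat_def)
  also have "coeff (\<Prod>j\<in>?R. [:of_nat c - of_nat j, 1:]) 0
      = (\<Prod>j\<in>?R. of_nat c - of_nat j :: rat)"
    by (simp only: poly_prod poly_pCons poly_0 mult_zero_left add_0_right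
        flip: poly_0_coeff_0)
  also have "(\<Prod>j\<in>?R. of_nat c - of_nat j :: rat)
      = (\<Prod>j<c. of_nat c - of_nat j) * (\<Prod>j\<in>{c<..m}. of_nat c - of_nat j)"
  proof -
    have "?R = {..<c} \<union> {c<..m}" using assms(1) by auto
    moreover have "{..<c} \<inter> {c<..m} = {}" by auto
    ultimately show ?thesis by (simp add: prod.union_disjoint)
  qed
  also have "(\<Prod>j\<in>{c<..m}. of_nat c - of_nat j :: rat)
      = (\<Prod>j\<in>{c<..m}. (-1) * (of_nat j - of_nat c))"
    by simp
  also have "\<dots> = (-1) ^ k * (\<Prod>j\<in>{c<..m}. of_nat j - of_nat c)"
    using assms(1) by (subst prod.distrib) auto
  finally have "(-1) ^ k * coeff p 1 = 1 / fact (Suc m) * ((\<Prod>j<c. of_nat c - of_nat j)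
      * (\<Prod>j\<in>{c<..m}. of_nat j - of_nat c)) * ((-1) ^ k * (-1) ^ k)"
    by (simp add: mult_ac)
  moreover have "((-1) ^ k * (-1) ^ k :: rat) = 1"
    by (simp flip: power_add add: mult_2[symmetric])
  moreover have "(\<Prod>j<c. of_nat c - of_nat j :: rat) \<ge> 0"
    by (intro prod_nonneg) auto
  moreover have "(\<Prod>j\<in>{c<..m}. of_nat j - of_nat c :: rat) \<ge> 0"
    by (intro prod_nonneg) auto
  ultimately show "(-1) ^ k * coeff p 1 \<ge> 0" by simp
qed

section \<open>The linear coefficient of an order polynomial\<close>
lemma coeff_1_mult_eq_0:
  fixes p q :: "rat poly"
  assumes "coeff p 0 = 0" "coeff q 0 = 0"
  shows "coeff (p * q) 1 = 0"
  using assms by (simp add: coeff_mult)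

text \<open>
  The induction removes one descent \<open>i\<close> at a time. Dropping the condition at \<open>i\<close> splits the
  interval into two pieces whose order polynomials multiply to a polynomial without linear term;
  subtracting the order polynomial for a strict ascent at \<open>i\<close> therefore
  negates the linear coefficient, and this matches the change in the number of strict steps. The
  same recursion shows that the counting function is a polynomial.
\<close>
lemma interval_order_poly:
  assumes "\<And>i. a \<le> i \<Longrightarrow> i < a + m \<Longrightarrow> r i \<noteq> Free"
  shows "\<exists>p. is_order_poly r {a..<Suc (a + m)} p
             \<and> (-1) ^ strict_steps r {a..<Suc (a + m)} * coeff p 1 \<ge> 0"
  using assms
proof (induction "card {i \<in> {a..<a + m}. r i = Weak_Down}" arbitrary: r a m rule: less_induct)
  case less
  let ?S = "{a..<Suc (a + m)}"
  show ?case
  proof (cases "\<exists>i\<in>{a..<a + m}. r i = Weak_Down")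
    case False
    then have up: "r i \<in> {Weak_Up, Strict_Up}" if "a \<le> i" "i < a + m" for i
      using less.prems that by (cases "r i") auto
    let ?k = "strict_steps r ?S"
    have "(m - ?k) + ?k = m" using strict_steps_le[of r a m] by simp
    note chain = coeff_1_chain_poly[OF this]
    let ?p = "smult (1 / fact (Suc m)) (\<Prod>j<Suc m. [:of_nat (m - ?k) - of_nat j, 1:]) :: rat poly"
    have "is_order_poly r ?S ?p"
      unfolding is_order_poly_def
      by (intro allI) (simp only: chain(1) card_fence_maps_chain[OF up])
    with chain(2) show ?thesis by blast
  next
    case True
    then obtain i where i: "a \<le> i" "i < a + m" "r i = Weak_Down" by auto
    let ?D = "\<lambda>r a m. {i \<in> {a..<a + m}. r i = Weak_Down}"
    obtain e where e: "i = a + e" using i(1) le_Suc_ex by blast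
    obtain d where d: "a + m = Suc i + d" using i(2) less_iff_Suc_add by auto
    let ?S1 = "{a..<Suc i}" and ?S2 = "{Suc i..<Suc (Suc i + d)}"
    have S: "?S = ?S1 \<union> ?S2" using i d by auto
    have smaller: "card E < card (?D r a m)" if "E \<subseteq> ?D r a m" "i \<notin> E" for E
    proof (rule psubset_card_mono)
      have "i \<in> ?D r a m" using i by simp
      then show "E \<subset> ?D r a m" using that by blast
    qed simp
    have lt: "card (?D (r(i := Strict_Up)) a m) < card (?D r a m)"
      by (rule smaller) (auto split: if_splits)
    have nf: "(r(i := Strict_Up)) j \<noteq> Free" if "a \<le> j" "j < a + m" for j
      using less.prems that by simp
    obtain q where q: "is_order_poly (r(i := Strict_Up)) ?S q"
      "(-1) ^ strict_steps (r(i := Strict_Up)) ?S * coeff q 1 \<ge> 0"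
      using less.hyps[OF lt nf] by blast
    have lt1: "card (?D r a e) < card (?D r a m)"
      by (rule smaller) (use d e in auto)
    have nf1: "r j \<noteq> Free" if "a \<le> j" "j < a + e" for j
      using less.prems that d e by simp
    obtain p1 where p1: "is_order_poly r ?S1 p1"
      using less.hyps[OF lt1 nf1] unfolding e by blast
    have lt2: "card (?D r (Suc i) d) < card (?D r a m)"
      by (rule smaller) (use d i in auto)
    have nf2: "r j \<noteq> Free" if "Suc i \<le> j" "j < Suc i + d" for j
      using less.prems that d i by simp
    obtain p2 where p2: "is_order_poly r ?S2 p2"
      using less.hyps[OF lt2 nf2] by blast
    have "card (fence_maps r ?S t) + card (fence_maps (r(i := Strict_Up)) ?S t)
        = card (fence_maps r ?S1 t) * card (fence_maps r ?S2 t)" for t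
    proof -
      have "r(i := Weak_Down) = r" using i by auto
      then have "card (fence_maps r ?S t) + card (fence_maps (r(i := Strict_Up)) ?S t)
          = card (fence_maps (r(i := Free)) ?S t)"
        using card_fence_maps_flip[of ?S i r t] i by auto
      also have "\<dots> = card (fence_maps (r(i := Free)) ?S1 t) * card (fence_maps (r(i := Free)) ?S2 t)"
        unfolding S by (rule card_fence_maps_Un) auto
      also have "fence_maps (r(i := Free)) ?S1 t = fence_maps r ?S1 t"
        by (rule fence_maps_cong) auto
      also have "fence_maps (r(i := Free)) ?S2 t = fence_maps r ?S2 t"
        by (rule fence_maps_cong) auto
      finally show ?thesis .
    qed
    then have "of_nat (card (fence_maps r ?S t)) + of_nat (card (fence_maps (r(i := Strict_Up)) ?S t))
        = (of_nat (card (fence_maps r ?S1 t)) * of_nat (card (fence_maps r ?S2 t)) :: rat)" for t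
      by (metis of_nat_add of_nat_mult)
    then have "is_order_poly r ?S (p1 * p2 - q)"
      using p1 p2 q(1) unfolding is_order_poly_def by (simp add: algebra_simps)
    moreover have "coeff (p1 * p2) 1 = 0"
      using order_poly_coeff_0[OF p1] order_poly_coeff_0[OF p2] i
      by (intro coeff_1_mult_eq_0) auto
    moreover have "strict_steps (r(i := Strict_Up)) ?S = Suc (strict_steps r ?S)"
    proof -
      have "{j \<in> ?S. Suc j \<in> ?S \<and> (r(i := Strict_Up)) j = Strict_Up}
          = insert i {j \<in> ?S. Suc j \<in> ?S \<and> r j = Strict_Up}"
        using i by auto
      then show ?thesis unfolding strict_steps_def using i by simp
    qed
    ultimately show ?thesis using q(2) by (intro exI[of _ "p1 * p2 - q"]) auto
  qed
qed

lemma interval_or_gap: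
  fixes S :: "nat set"
  assumes "finite S" "S \<noteq> {}"
  obtains (interval) a m where "S = {a..<Suc (a + m)}"
  | (gap) g where "g \<notin> S" "S \<inter> {..<g} \<noteq> {}" "S \<inter> {g<..} \<noteq> {}"
proof (cases "S = {Min S..Max S}")
  case True
  have "Min S \<le> Max S" using assms by simp
  then have "{Min S..Max S} = {Min S..<Suc (Min S + (Max S - Min S))}" by auto
  with True have "S = {Min S..<Suc (Min S + (Max S - Min S))}" by (rule trans)
  then show ?thesis by (rule interval)
next
  case False
  moreover have "S \<subseteq> {Min S..Max S}" using assms by auto
  ultimately have "\<exists>g. g \<in> {Min S..Max S} \<and> g \<notin> S" by blast
  then obtain g where g: "Min S \<le> g" "g \<le> Max S" "g \<notin> S" by auto
  have "Min S \<in> S" "Max S \<in> S" using assms by auto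
  with g have "Min S \<in> S \<inter> {..<g}" "Max S \<in> S \<inter> {g<..}"
    by (auto simp: order.order_iff_strict)
  then show ?thesis using g(3) by (intro gap[of g]) auto
qed

text \<open>
  A fence has no strict steps, so the sign in the interval case is positive. Across a gap the
  order polynomial factors into two polynomials without constant term.
\<close>
lemma order_poly_linear_coeff_nonneg:
  assumes "finite S" and "range r \<subseteq> {Weak_Up, Weak_Down}"
  shows "\<exists>p. is_order_poly r S p \<and> coeff p 1 \<ge> 0"
  using assms(1)
proof (induction "card S" arbitrary: S rule: less_induct)
  case less
  show ?case
  proof (cases "S = {}")
    case True
    then show ?thesis
      by (intro exI[of _ 1]) (simp add: is_order_poly_def fence_maps_empty)
  next
    case False
    with less.prems show ?thesis
    proof (cases rule: interval_or_gap)
      case (interval a m)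
      have "r i = Weak_Up \<or> r i = Weak_Down" for i using assms(2) by auto
      then have "r i \<noteq> Free" "r i \<noteq> Strict_Up" for i by (metis step.distinct)+
      then show ?thesis
        using interval_order_poly[of a m r] interval by (simp add: strict_steps_def)
    next
      case (gap g)
      let ?S1 = "S \<inter> {..<g}" and ?S2 = "S \<inter> {g<..}"
      have "x < g \<or> g < x" if "x \<in> S" for x using gap(1) that by (metis linorder_neqE_nat)
      then have S: "S = ?S1 \<union> ?S2" by blast
      obtain u v where uv: "u \<in> S" "u < g" "v \<in> S" "g < v" using gap(2,3) by auto
      have "u \<notin> ?S2" "v \<notin> ?S1" using uv by auto
      then have "?S1 \<subset> S" "?S2 \<subset> S" using uv(1,3) by blast+
      note smaller = this[THEN psubset_card_mono[OF less.prems]]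
      obtain p1 where p1: "is_order_poly r ?S1 p1"
        using less.hyps[OF smaller(1)] less.prems by blast
      obtain p2 where p2: "is_order_poly r ?S2 p2"
        using less.hyps[OF smaller(2)] less.prems by blast
      have "card (fence_maps r S t) = card (fence_maps r ?S1 t) * card (fence_maps r ?S2 t)" for t
        by (subst S, rule card_fence_maps_Un) (use gap in auto)
      then have "is_order_poly r S (p1 * p2)"
        using p1 p2 by (simp add: is_order_poly_def)
      moreover have "coeff (p1 * p2) 1 = 0"
        using order_poly_coeff_0[OF p1] order_poly_coeff_0[OF p2] gap
        by (intro coeff_1_mult_eq_0) auto
      ultimately show ?thesis by auto
    qed
  qed
qed

section \<open>The derivative of an order polynomial\<close>
definition lower_sets :: "(nat \<Rightarrow> step) \<Rightarrow> nat set \<Rightarrow> nat set set" where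
  "lower_sets r S = {I. I \<subseteq> S \<and> (\<forall>i. i \<in> S \<longrightarrow> Suc i \<in> S \<longrightarrow>
      (r i = Weak_Up \<longrightarrow> Suc i \<in> I \<longrightarrow> i \<in> I) \<and> (r i = Weak_Down \<longrightarrow> i \<in> I \<longrightarrow> Suc i \<in> I))}"

text \<open>
  The points of height less than \<open>s\<close> form a lower set \<open>I\<close>. A map is determined by \<open>I\<close>, its values
  on \<open>I\<close>, and its values on the rest lowered by \<open>s\<close>. Conversely, two such pieces always fit
  together: a condition between a point inside and a point outside \<open>I\<close> holds because
  \<open>I\<close> is a lower set.
\<close>
lemma card_fence_maps_add:
  assumes fin: "finite S" and r: "range r \<subseteq> {Weak_Up, Weak_Down}"
  shows "card (fence_maps r S (s + t))
       = (\<Sum>I\<in>lower_sets r S. card (fence_maps r I s) * card (fence_maps r (S - I) t))"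
proof -
  let ?T = "SIGMA I:lower_sets r S. fence_maps r I s \<times> fence_maps r (S - I) t"
  let ?low = "\<lambda>f. {i \<in> S. f i < s}"
  let ?cut = "\<lambda>f. (?low f, restrict f (?low f), \<lambda>i\<in>S - ?low f. f i - s)"
  \<comment> \<open>The values outside \<open>S\<close> are \<open>undefined\<close> because \<open>fence_maps\<close> consists of extensional functions.\<close>
  let ?glue = "\<lambda>(I, g, h) i. if i \<in> I then g i else if i \<in> S then s + h i else undefined"
  have r2: "r i = Weak_Up \<or> r i = Weak_Down" for i using r by auto
  have "bij_betw ?cut (fence_maps r S (s + t)) ?T"
  proof (rule bij_betw_byWitness[where f' = ?glue])
    show "\<forall>f\<in>fence_maps r S (s + t). ?glue (?cut f) = f"
      by (auto simp: fence_maps_def fun_eq_iff PiE_def extensional_def)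
    have "?cut (?glue (I, g, h)) = (I, g, h)"
      if I: "I \<in> lower_sets r S" and g: "g \<in> fence_maps r I s" and h: "h \<in> fence_maps r (S - I) t"
      for I g h
    proof -
      have "?low (?glue (I, g, h)) = I"
        using I g by (auto simp: lower_sets_def fence_maps_def split: if_splits)
      then show ?thesis
        using g h I by (auto simp: fence_maps_def fun_eq_iff PiE_def extensional_def lower_sets_def)
    qed
    then show "\<forall>x\<in>?T. ?cut (?glue x) = x" by blast
    have "?cut f \<in> ?T" if f: "f \<in> fence_maps r S (s + t)" for f
    proof -
      have steps: "step_holds (r i) (f i) (f (Suc i))" if "i \<in> S" "Suc i \<in> S" for i
        using f that by (auto simp: fence_maps_def)
      have vals: "f i < s + t" if "i \<in> S" for i
        using f that by (auto simp: fence_maps_def)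
      have "?low f \<in> lower_sets r S"
        unfolding lower_sets_def using steps by fastforce
      moreover have "restrict f (?low f) \<in> fence_maps r (?low f) s"
        using steps by (auto simp: fence_maps_def)
      moreover have "step_holds (r i) (f i - s) (f (Suc i) - s)" if "i \<in> S" "Suc i \<in> S" for i
        using r2[of i] steps[OF that] by auto
      then have "(\<lambda>i\<in>S - ?low f. f i - s) \<in> fence_maps r (S - ?low f) t"
        using vals by (force simp: fence_maps_def)
      ultimately show ?thesis by blast
    qed
    then show "?cut ` fence_maps r S (s + t) \<subseteq> ?T" by blast
    have "?glue (I, g, h) \<in> fence_maps r S (s + t)"
      if I: "I \<in> lower_sets r S" and g: "g \<in> fence_maps r I s" and h: "h \<in> fence_maps r (S - I) t"
      for I g h
    proof -
      have IS: "I \<subseteq> S" using I by (simp add: lower_sets_def)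
      have gv: "g i < s" if "i \<in> I" for i
        using g that by (auto simp: fence_maps_def)
      have hv: "h i < t" if "i \<in> S" "i \<notin> I" for i
        using h that by (auto simp: fence_maps_def)
      have gs: "step_holds (r i) (g i) (g (Suc i))" if "i \<in> I" "Suc i \<in> I" for i
        using g that by (auto simp: fence_maps_def)
      have hs: "step_holds (r i) (h i) (h (Suc i))"
        if "i \<in> S" "Suc i \<in> S" "i \<notin> I" "Suc i \<notin> I" for i
        using h that by (auto simp: fence_maps_def)
      have "step_holds (r i) (?glue (I, g, h) i) (?glue (I, g, h) (Suc i))"
        if i: "i \<in> S" "Suc i \<in> S" for i
      proof -
        have "r i = Weak_Up \<Longrightarrow> Suc i \<in> I \<Longrightarrow> i \<in> I" "r i = Weak_Down \<Longrightarrow> i \<in> I \<Longrightarrow> Suc i \<in> I"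
          using I i by (auto simp: lower_sets_def)
        then show ?thesis
          using r2[of i] i gs[of i] hs[of i] gv[of i] gv[of "Suc i"] by auto
      qed
      moreover have "?glue (I, g, h) i < s + t" if "i \<in> S" for i
        using that gv[of i] hv[of i] by auto
      moreover have "?glue (I, g, h) i = undefined" if "i \<notin> S" for i
        using that IS by auto
      ultimately show ?thesis
        unfolding fence_maps_def PiE_def extensional_def Pi_def by blast
    qed
    then show "?glue ` ?T \<subseteq> fence_maps r S (s + t)" by auto
  qed
  then have "card (fence_maps r S (s + t)) = card ?T"
    by (rule bij_betw_same_card)
  also have "\<dots> = (\<Sum>I\<in>lower_sets r S. card (fence_maps r I s \<times> fence_maps r (S - I) t))"
  proof (rule card_SigmaI)
    have "lower_sets r S \<subseteq> Pow S" by (auto simp: lower_sets_def)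
    then show "finite (lower_sets r S)" using fin by (auto intro: finite_subset)
    show "\<forall>I\<in>lower_sets r S. finite (fence_maps r I s \<times> fence_maps r (S - I) t)"
      using fin by (auto simp: lower_sets_def intro!: finite_fence_maps intro: finite_subset)
  qed
  finally show ?thesis by (simp add: card_cartesian_product)
qed

lemma coeff_1_shift: "coeff (p \<circ>\<^sub>p [:c, 1:]) 1 = poly (pderiv p) c" for p :: "rat poly"
proof -
  have "coeff (p \<circ>\<^sub>p [:c, 1:]) 1 = poly (pderiv (p \<circ>\<^sub>p [:c, 1:])) 0"
    by (simp add: poly_0_coeff_0 coeff_pderiv)
  then show ?thesis by (simp add: pderiv_pcompose pderiv_pCons poly_pcompose)
qed

text \<open>
  For fixed \<open>t\<close> both sides of the addition formula are polynomials in \<open>s\<close>; this compares their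
  linear coefficients.
\<close>
lemma pderiv_order_poly:
  assumes fin: "finite S" and r: "range r \<subseteq> {Weak_Up, Weak_Down}"
    and P: "\<And>I. I \<subseteq> S \<Longrightarrow> is_order_poly r I (P I)"
  shows "pderiv (P S) = (\<Sum>I\<in>lower_sets r S. smult (coeff (P I) 1) (P (S - I)))"
proof (rule poly_eq_of_nat)
  fix t :: nat
  have ls: "I \<subseteq> S" if "I \<in> lower_sets r S" for I using that by (simp add: lower_sets_def)
  have "P S \<circ>\<^sub>p [:of_nat t, 1:]
      = (\<Sum>I\<in>lower_sets r S. smult (poly (P (S - I)) (of_nat t)) (P I))"
  proof (rule poly_eq_of_nat)
    fix s :: nat
    have "poly (P S \<circ>\<^sub>p [:of_nat t, 1:]) (of_nat s) = of_nat (card (fence_maps r S (s + t)))"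
    proof -
      have "poly (P S) (of_nat (s + t)) = of_nat (card (fence_maps r S (s + t)))"
        using P[of S] unfolding is_order_poly_def by blast
      then show ?thesis by (simp add: poly_pcompose add.commute)
    qed
    also have "\<dots> = (\<Sum>I\<in>lower_sets r S. poly (P I) (of_nat s) * poly (P (S - I)) (of_nat t))"
      using P ls by (simp add: card_fence_maps_add[OF fin r] is_order_poly_def)
    finally show "poly (P S \<circ>\<^sub>p [:of_nat t, 1:]) (of_nat s)
        = poly (\<Sum>I\<in>lower_sets r S. smult (poly (P (S - I)) (of_nat t)) (P I)) (of_nat s)"
      by (simp add: poly_sum mult.commute)
  qed
  then have "coeff (P S \<circ>\<^sub>p [:of_nat t, 1:]) 1
      = (\<Sum>I\<in>lower_sets r S. poly (P (S - I)) (of_nat t) * coeff (P I) 1)"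
    by (simp add: coeff_sum)
  then show "poly (pderiv (P S)) (of_nat t)
      = poly (\<Sum>I\<in>lower_sets r S. smult (coeff (P I) 1) (P (S - I))) (of_nat t)"
    by (simp only: coeff_1_shift poly_sum poly_smult mult.commute)
qed

text \<open>
  In the formula for the derivative the lower set \<open>I = {}\<close> would lead back to \<open>S\<close> itself, but its
  order polynomial is constant, so that this term vanishes and induction applies to the others.
\<close>
lemma order_poly_coeffs_nonneg:
  assumes fin: "finite S" and r: "range r \<subseteq> {Weak_Up, Weak_Down}"
  shows "\<exists>p. is_order_poly r S p \<and> (\<forall>i. coeff p i \<ge> 0)"
proof -
  obtain P where P: "\<And>I. finite I \<Longrightarrow> is_order_poly r I (P I) \<and> coeff (P I) 1 \<ge> 0"
    using order_poly_linear_coeff_nonneg[OF _ r] by metis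
  have "\<forall>i. coeff (P S) i \<ge> 0"
    using fin
  proof (induction "card S" arbitrary: S rule: less_induct)
    case less
    have P_empty: "P {} = 1"
      by (rule order_poly_unique[of r "{}"]) (use P in \<open>auto simp: is_order_poly_def fence_maps_empty\<close>)
    show ?case
    proof (cases "S = {}")
      case True
      then show ?thesis by (simp add: P_empty)
    next
      case False
      have deriv: "pderiv (P S) = (\<Sum>I\<in>lower_sets r S. smult (coeff (P I) 1) (P (S - I)))"
        using P less.prems by (intro pderiv_order_poly[OF _ r]) (auto intro: finite_subset)
      have "coeff (P I) 1 * coeff (P (S - I)) i \<ge> 0" if I: "I \<in> lower_sets r S" for I i
      proof (cases "I = {}")
        case True
        then show ?thesis by (simp add: P_empty)
      next
        case False
        have IS: "I \<subseteq> S" using I by (simp add: lower_sets_def)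
        then have "card (S - I) < card S"
          using False less.prems by (intro psubset_card_mono) auto
        then have "coeff (P (S - I)) i \<ge> 0" using less.hyps less.prems by simp
        moreover have "coeff (P I) 1 \<ge> 0"
          using P IS less.prems by (meson finite_subset)
        ultimately show ?thesis by simp
      qed
      then have d: "coeff (pderiv (P S)) i \<ge> 0" for i
        unfolding deriv by (auto simp: coeff_sum intro: sum_nonneg)
      have "coeff (P S) i \<ge> 0" for i
      proof (cases i)
        case 0
        then show ?thesis using order_poly_coeff_0[of r S "P S"] P False less.prems by auto
      next
        case (Suc j)
        have "of_nat (Suc j) * coeff (P S) (Suc j) \<ge> 0" using d[of j] by (simp only: coeff_pderiv)
        then show ?thesis using Suc by (simp add: zero_le_mult_iff del: of_nat_Suc)
      qed
      then show ?thesis by blast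
    qed
  qed
  then show ?thesis using P[OF fin] by blast
qed

section \<open>Lattice points of dilated shard polytopes\<close>

text \<open>
  The falls are the local maxima of a sequence that ascends into \<open>A\<close> and descends into \<open>B\<close>. From
  a point of \<open>A\<close>, or from \<open>a\<close>, walking to the right along ascents ends in a fall; from a point of
  \<open>B\<close>, the values grow to the left until such a starting point is reached. Applied to \<open>- y\<close> with \<open>A\<close> and \<open>B\<close>
  exchanged, the lemma bounds a sequence from below by its rises.
\<close>
lemma bounded_if_falls_bounded:
  fixes y :: "nat \<Rightarrow> real"
  assumes AB: "A \<union> B = {a+1..b-1}"
    and A: "\<And>i. i \<in> A \<Longrightarrow> y (i - 1) \<le> y i"
    and B: "\<And>i. i \<in> B \<Longrightarrow> y i \<le> y (i - 1)"
    and falls: "\<And>f. f \<in> falls a b A B \<Longrightarrow> y f \<le> c"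
    and j: "a \<le> j" "j < b"
  shows "y j \<le> c"
proof -
  have right: "y j \<le> c" if "j \<in> insert a A" "a \<le> j" "j \<le> b - 1" "a < b" for j
    using that(3,1,2)
  proof (induction rule: inc_induct)
    case base
    then have "b - 1 \<in> falls a b A B" using \<open>a < b\<close> by (auto simp: falls_def)
    then show ?case by (rule falls)
  next
    case (step k)
    then consider "Suc k \<in> A" | "Suc k \<in> B" using AB by force
    then show ?case
    proof cases
      case 1
      then show ?thesis using A[of "Suc k"] step by force
    next
      case 2
      then have "k \<in> falls a b A B" using step by (auto simp: falls_def)
      then show ?thesis by (rule falls)
    qed
  qed
  from j show ?thesis
  proof (induction rule: dec_induct)
    case base
    then show ?case using right[of a] by auto
  next
    case (step k)
    then consider "Suc k \<in> A" | "Suc k \<in> B" using AB by force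
    then show ?case
    proof cases
      case 1
      then show ?thesis using right[of "Suc k"] step by auto
    next
      case 2
      then show ?thesis using B[of "Suc k"] step by auto
    qed
  qed
qed

lemma rises_eq_falls: "rises a b A B = falls a b B A"
  by (simp add: rises_def falls_def)

lemma dilate_shard_polytope:
  assumes "t > 0"
  shows "x \<in> dilate t (shard_polytope n a b A B) \<longleftrightarrow>
     x \<in> real_space n \<and> (\<Sum>i=1..n. x i) = 0 \<and>
     (\<forall>i \<in> {1..n} - {a..b}. x i = 0) \<and> (\<forall>i\<in>A. x i \<ge> 0) \<and> (\<forall>i\<in>B. x i \<le> 0) \<and>
     (\<forall>f \<in> falls a b A B. (\<Sum>i=1..f. x i) \<le> real t) \<and>
     (\<forall>r \<in> rises a b A B. (\<Sum>i=1..r. x i) \<ge> 0)"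
    (is "?L \<longleftrightarrow> ?R")
proof
  assume ?L
  then obtain z where "z \<in> shard_polytope n a b A B" "x = (\<lambda>i. real t * z i)"
    by (auto simp: dilate_def)
  then show ?R
    by (auto simp: shard_polytope_def real_space_def mult_nonneg_nonpos mult_left_le
        simp flip: sum_distrib_left)
next
  assume R: ?R
  let ?z = "\<lambda>i. x i / real t"
  have "?z \<in> shard_polytope n a b A B"
    using R assms
    by (auto simp: shard_polytope_def real_space_def divide_nonpos_pos
        simp flip: sum_divide_distrib)
  moreover have "x = (\<lambda>i. real t * ?z i)" using assms by simp
  ultimately show ?L
    unfolding dilate_def by (intro image_eqI[of _ _ ?z])
qed

definition arc_steps :: "nat set \<Rightarrow> nat \<Rightarrow> step" where
  "arc_steps A i = (if Suc i \<in> A then Weak_Up else Weak_Down)"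

text \<open>
  The value 0 outside \<open>{a..<b}\<close> represents the partial sums of a point of the polytope there:
  they are empty before \<open>a\<close>, and from \<open>b\<close> on they are the total sum, which vanishes.
\<close>
definition heights :: "nat \<Rightarrow> nat \<Rightarrow> (nat \<Rightarrow> nat) \<Rightarrow> nat \<Rightarrow> real" where
  "heights a b f i = (if a \<le> i \<and> i < b then real (f i) else 0)"

definition increments :: "nat \<Rightarrow> nat \<Rightarrow> (nat \<Rightarrow> nat) \<Rightarrow> nat \<Rightarrow> real" where
  "increments a b f i = heights a b f i - heights a b f (i - 1)"

lemma sum_increments:
  assumes "a \<ge> 1"
  shows "(\<Sum>i=1..j. increments a b f i) = heights a b f j"
proof (induction j)
  case 0
  then show ?case using assms by (simp add: heights_def)
next
  case (Suc j)
  then show ?case by (simp add: increments_def)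
qed

text \<open>
  The inverse map takes partial sums. It is well defined because these are integers between
  \<open>0\<close> and \<open>t\<close>; this range has \<open>Suc t\<close> elements.
\<close>
lemma bij_betw_lattice_points:
  assumes arc: "is_arc n a b A B" and t: "t > 0"
  shows "bij_betw (increments a b) (fence_maps (arc_steps A) {a..<b} (Suc t))
           (dilate t (shard_polytope n a b A B) \<inter> int_lattice n)"
proof -
  have ab: "1 \<le> a" "a < b" "b \<le> n" and AB: "A \<union> B = {a+1..b-1}" "A \<inter> B = {}"
    using arc by (auto simp: is_arc_def)
  have A_range: "a < i" "i < b" if "i \<in> A" for i
  proof -
    have "i \<in> {a+1..b-1}" using that AB(1) by blast
    then show "a < i" "i < b" by auto
  qed
  have B_range: "a < i" "i < b" "i \<notin> A" if "i \<in> B" for i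
  proof -
    have "i \<in> {a+1..b-1}" using that AB(1) by blast
    then show "a < i" "i < b" by auto
    show "i \<notin> A" using that AB(2) by blast
  qed
  have fall_range: "a \<le> j" "j < b" if "j \<in> falls a b A B \<union> rises a b A B" for j
    using that ab by (auto simp: falls_def rises_def)
  let ?M = "fence_maps (arc_steps A) {a..<b} (Suc t)"
  show ?thesis
    unfolding bij_betw_def
  proof (intro conjI inj_onI equalityI subsetI)
    fix f g assume f: "f \<in> ?M" and g: "g \<in> ?M" and eq: "increments a b f = increments a b g"
    have "heights a b f j = heights a b g j" for j
      using sum_increments[OF ab(1)] eq by metis
    then have "f j = g j" if "j \<in> {a..<b}" for j
      using that by (metis atLeastLessThan_iff heights_def of_nat_eq_iff)
    moreover have "f j = g j" if "j \<notin> {a..<b}" for j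
      using that f g by (auto simp: fence_maps_def PiE_def extensional_def)
    ultimately show "f = g" by blast
  next
    fix x assume "x \<in> increments a b ` ?M"
    then obtain f where f: "f \<in> ?M" and x: "x = increments a b f" by blast
    have sums: "(\<Sum>i=1..j. x i) = heights a b f j" for j
      unfolding x by (rule sum_increments[OF ab(1)])
    have vals: "f j \<le> t" if "a \<le> j" "j < b" for j
    proof -
      have "j \<in> {a..<b}" using that by simp
      then have "f j < Suc t" using f unfolding fence_maps_def by blast
      then show ?thesis by simp
    qed
    have steps: "step_holds (arc_steps A (i - 1)) (f (i - 1)) (f i)" if "a < i" "i < b" for i
    proof -
      have "i - 1 \<in> {a..<b}" "Suc (i - 1) \<in> {a..<b}" using that by auto
      then have "step_holds (arc_steps A (i - 1)) (f (i - 1)) (f (Suc (i - 1)))"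
        using f unfolding fence_maps_def by blast
      then show ?thesis using that by simp
    qed
    have "x i \<ge> 0" if "i \<in> A" for i
      using steps[OF A_range[OF that]] A_range[OF that] that
      by (auto simp: x increments_def heights_def arc_steps_def)
    moreover have "x i \<le> 0" if "i \<in> B" for i
      using steps[of i] B_range[OF that]
      by (auto simp: x increments_def heights_def arc_steps_def)
    moreover have "x i = 0" if "i \<notin> {a..b}" for i
      using that ab by (auto simp: x increments_def heights_def)
    moreover have "(\<Sum>i=1..n. x i) = 0"
      unfolding sums heights_def using ab by simp
    moreover have "(\<Sum>i=1..j. x i) \<le> real t" "(\<Sum>i=1..j. x i) \<ge> 0"
      if "j \<in> falls a b A B \<union> rises a b A B" for j
      unfolding sums heights_def using fall_range[OF that] vals by simp_all
    moreover have "x i \<in> \<int>" for i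
      by (auto simp: x increments_def heights_def)
    ultimately show "x \<in> dilate t (shard_polytope n a b A B) \<inter> int_lattice n"
      unfolding dilate_shard_polytope[OF t] Int_iff int_lattice_def real_space_def
      using ab by auto
  next
    fix x assume x: "x \<in> dilate t (shard_polytope n a b A B) \<inter> int_lattice n"
    define y where "y j = (\<Sum>i=1..j. x i)" for j
    have D: "x \<in> real_space n" "y n = 0" "\<forall>i \<in> {1..n} - {a..b}. x i = 0"
      "\<forall>i\<in>A. x i \<ge> 0" "\<forall>i\<in>B. x i \<le> 0" "\<forall>f \<in> falls a b A B. y f \<le> real t"
      "\<forall>r \<in> rises a b A B. y r \<ge> 0"
      using x by (auto simp: dilate_shard_polytope[OF t] y_def)
    have x0: "x i = 0" if "i \<notin> {a..b}" for i
      using D(1,3) that unfolding real_space_def by blast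
    have diff: "y j - y (j - 1) = x j" for j
    proof (cases j)
      case 0
      then show ?thesis using x0[of 0] ab by (simp add: y_def)
    next
      case (Suc k)
      then show ?thesis by (simp add: y_def)
    qed
    have y_low: "y j = 0" if "j < a" for j
      unfolding y_def by (rule sum.neutral) (use that x0 in auto)
    have y_high: "y j = 0" if "b \<le> j" for j
    proof -
      have "y j = y b" using that
      proof (induction rule: dec_induct)
        case (step k)
        then show ?case using diff[of "Suc k"] x0[of "Suc k"] by simp
      qed simp
      moreover have "y n = y b" using ab(3)
      proof (induction rule: dec_induct)
        case (step k)
        then show ?case using diff[of "Suc k"] x0[of "Suc k"] by simp
      qed simp
      ultimately show ?thesis using D(2) by simp
    qed
    have up: "y (i - 1) \<le> y i" if "i \<in> A" for i
      using diff[of i] D(4) that by force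
    have down: "y i \<le> y (i - 1)" if "i \<in> B" for i
      using diff[of i] D(5) that by force
    have upper: "y j \<le> real t" if "a \<le> j" "j < b" for j
      by (rule bounded_if_falls_bounded[where y = y, OF AB(1) _ _ _ that])
        (use up down D(6) in auto)
    have BA: "B \<union> A = {a+1..b-1}" using AB(1) by blast
    have lower: "- y j \<le> 0" if "a \<le> j" "j < b" for j
      by (rule bounded_if_falls_bounded[where y = "\<lambda>j. - y j", OF BA _ _ _ that])
        (use up down D(7) in \<open>auto simp: rises_eq_falls\<close>)
    have y_int: "y j \<in> \<int>" for j
      unfolding y_def using x x0 ab by (intro Ints_sum) (auto simp: int_lattice_def real_space_def)
    define h where "h j = nat \<lfloor>y j\<rfloor>" for j
    have h: "real (h j) = y j" if "a \<le> j" "j < b" for j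
      using lower[OF that] y_int[of j] by (auto simp: h_def elim!: Ints_cases)
    define f where "f = restrict h {a..<b}"
    have fy: "heights a b f j = y j" for j
      using h[of j] y_low[of j] y_high[of j] by (auto simp: heights_def f_def)
    have "f \<in> ?M"
    proof -
      have "h j \<le> t" if "a \<le> j" "j < b" for j
        using upper[OF that] h[OF that] by simp
      moreover have "step_holds (arc_steps A i) (h i) (h (Suc i))" if "a \<le> i" "Suc i < b" for i
      proof -
        have hh: "real (h i) = y i" "real (h (Suc i)) = y (Suc i)" using h that by auto
        have "Suc i \<in> A \<union> B" unfolding AB(1) using that by auto
        then show ?thesis
          using hh up[of "Suc i"] down[of "Suc i"] AB(2) by (auto simp: arc_steps_def)
      qed
      ultimately show ?thesis by (auto simp: fence_maps_def f_def less_Suc_eq_le)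
    qed
    moreover have "x = increments a b f"
      by (rule ext) (simp only: increments_def fy diff)
    ultimately show "x \<in> increments a b ` ?M" by blast
  qed
qed

section \<open>Ehrhart positivity\<close>
lemma coeff_mult_nonneg:
  fixes p q :: "rat poly"
  assumes "\<And>i. coeff p i \<ge> 0" "\<And>i. coeff q i \<ge> 0"
  shows "coeff (p * q) i \<ge> 0"
  using assms by (simp add: coeff_mult sum_nonneg)

lemma coeff_shift_nonneg:
  fixes p :: "rat poly"
  assumes "\<And>i. coeff p i \<ge> 0" "c \<ge> 0"
  shows "coeff (p \<circ>\<^sub>p [:c, 1:]) i \<ge> 0"
  using assms(1)
proof (induction p arbitrary: i)
  case 0
  then show ?case by simp
next
  case (pCons d p)
  have "coeff p j \<ge> 0" for j using pCons.prems[of "Suc j"] by simp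
  then have "coeff ([:c, 1:] * (p \<circ>\<^sub>p [:c, 1:])) i \<ge> 0"
    using pCons.IH assms(2) by (intro coeff_mult_nonneg) (auto simp: coeff_pCons split: nat.split)
  moreover have "coeff [:d:] i \<ge> 0"
    using pCons.prems[of 0] by (simp add: coeff_pCons split: nat.split)
  ultimately show ?case by (simp only: pcompose_pCons coeff_add)
qed

theorem corollary1p3:
  fixes n a b :: nat and A B :: "nat set"
  assumes "is_arc n a b A B"
  shows "ehrhart_positive n (shard_polytope n a b A B)"
proof -
  let ?r = "arc_steps A" and ?P = "shard_polytope n a b A B"
  have "range ?r \<subseteq> {Weak_Up, Weak_Down}" by (auto simp: arc_steps_def)
  then obtain p where p: "is_order_poly ?r {a..<b} p" "\<And>i. coeff p i \<ge> 0"
    using order_poly_coeffs_nonneg[of "{a..<b}" ?r] by auto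
  let ?q = "p \<circ>\<^sub>p [:1, 1:]"
  have "is_ehrhart_polynomial n ?P ?q"
    unfolding is_ehrhart_polynomial_def
  proof (intro allI impI conjI)
    fix t :: nat assume t: "t > 0"
    note bij = bij_betw_lattice_points[OF assms t]
    show "finite (dilate t ?P \<inter> int_lattice n)"
      using bij_betw_finite[OF bij] by (simp add: finite_fence_maps)
    have "poly ?q (of_nat t) = poly p (of_nat (Suc t))"
      by (simp add: poly_pcompose)
    then show "poly ?q (of_nat t) = of_nat (card (dilate t ?P \<inter> int_lattice n))"
      using p(1) bij_betw_same_card[OF bij] by (simp only: is_order_poly_def)
  qed
  moreover have "coeff ?q i \<ge> 0" for i
    using p(2) by (intro coeff_shift_nonneg) auto
  ultimately show ?thesis
    unfolding ehrhart_positive_def by (simp add: ehrhart_polynomial_eqI)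
qed

end
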